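(* Assume that, for each $i=1,\dots,K$, the Hamiltonian $H_i$ is coercive (i.e. $H_i(p_i,x_i)\to\infty$ as $|p_i|\to\infty$ uniformly for $x_i\in\bar I_i$), convex in $p_i$ and has no flat parts, and let $A\in\mathbb R$. Let $u,v\in C(\bar I)$ be respectively a continuous $A$-flux limited sub-solution and a continuous $A$-flux limited super-solution of the junction problem. Then $u\le v$ on $\bar I$.
   Context: Junction. Let $K$ be a positive integer and, for $i=1,\dots,K$, $I_i:=(-a_i,0)$ with $a_i\in(0,\infty]$. $I:=\bigcup_{i=1}^K I_i$, where the $I_i$ are regarded as distinct branches (the $i$-th one lying on the $i$-th coordinate axis of $\mathbb R^K$), and in $\bar I$ all branches are glued at the common point $0$, the junction. For $u\in C(\bar I;\mathbb R)$, $u_i$ (often written $u$) is the restriction of $u$ to $\bar I_i$ as a function of $x_i$; all $u_i$ take the same value $u(0)$ at $0$. $u_{x_i}$ denotes the derivative of $u_i$ in $x_i$. The Hamiltonians $H_i:\mathbb R\times\bar I_i\to\mathbb R$ are continuous. "No flat parts" means that $p\mapsto H_i(p,x_i)$ is not constant on any nondegenerate interval. Flux limiter. Let $p_i^0$ be the minimum point of $p\mapsto H_i(p,0)$. Let $H_i^-(p_i,0):=H_i(p_i,0)$ if $p_i\ge p_i^0$ and $H_i^-(p_i,0):=H_i(p_i^0,0)$ if $p_i\le p_i^0$ (the nondecreasing part of $H_i(\cdot,0)$; recall that each branch is $(-a_i,0)$, so $x_i$ increases towards the junction). For $A\in\mathbb R$ and $p=(p_1,\dots,p_K)$ set $H_A(p):=\max\big(A,\max_{1\le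 i\le K}H_i^-(p_i,0)\big)$. Definition. $u\in C(\bar I)$ is an $A$-flux limited sub-solution (resp. super-solution) of the junction problem if it is a viscosity sub-solution (resp. super-solution) of $u+H_i(u_{x_i},x_i)=0$ in $I_i$ for each $i$ and of $u+H_A(u_{x_1},\dots,u_{x_K})=0$ at $x=0$. The latter means: whenever $\phi$ is continuous on $\bar I$, with each $\phi_i$ being $C^1$ on $I_i\cup\{0\}$ (one-sided derivative at $0$), and $u-\phi$ has a local maximum (resp. local minimum) at $0$ relative to $\bar I$, then $u(0)+H_A(\phi_{x_1}(0),\dots,\phi_{x_K}(0))\le0$ (resp. $\ge0$). Boundary conditions at the end points. At each end point $x_i=-a_i$ a boundary condition (Dirichlet, Neumann or state-constraint, in the viscosity sense) is fixed, and all sub- and super-solutions are understood to satisfy it. It may be any condition for which comparison holds for the single-branch equation $w+H_i(w_{x_i},x_i)=0$ in $I_i$: a sub-solution lies below a super-solution on $\bar I_i$ as soon as this is so at $x_i=0$, or as soon as the super-solution is a state-constraint super-solution up to $x_i=0$. *)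

theory Defs
  imports "HOL-Analysis.Analysis"
begin

text \<open>
  The \<open>K\<close> branches are indexed by a finite type \<open>'k\<close> with \<open>K = CARD('k) \<ge> 1\<close>. The \<open>i\<close>-th branch is
  the set of points \<open>t *\<^sub>R axis i 1\<close> of \<open>real ^ 'k\<close> with \<open>t\<close> in an interval from \<open>- a i\<close> to \<open>0\<close>,
  where \<open>a i :: ereal\<close> may be infinite.
\<close>

definition branch :: "ereal \<Rightarrow> real set" where
  "branch a = {t. - a < ereal t \<and> t < 0}"

definition cbranch :: "ereal \<Rightarrow> real set" where
  "cbranch a = {t. - a \<le> ereal t \<and> t \<le> 0}"

definition on_branch :: "(real ^ 'k \<Rightarrow> real) \<Rightarrow> 'k::finite \<Rightarrow> real \<Rightarrow> real" where
  "on_branch u i t = u (t *\<^sub>R axis i 1)"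

definition junction :: "('k::finite \<Rightarrow> ereal) \<Rightarrow> (real ^ 'k) set" where
  "junction a = (\<Union>i. (\<lambda>t. t *\<^sub>R axis i 1) ` cbranch (a i))"

definition local_max_on :: "('a::topological_space \<Rightarrow> real) \<Rightarrow> 'a set \<Rightarrow> 'a \<Rightarrow> bool" where
  "local_max_on f S x \<longleftrightarrow> (\<forall>\<^sub>F y in at x within S. f y \<le> f x)"

definition local_min_on :: "('a::topological_space \<Rightarrow> real) \<Rightarrow> 'a set \<Rightarrow> 'a \<Rightarrow> bool" where
  "local_min_on f S x \<longleftrightarrow> (\<forall>\<^sub>F y in at x within S. f x \<le> f y)"

text \<open>\<open>\<phi>'\<close> is the derivative of the \<open>C\<^sup>1\<close> function \<open>\<phi>\<close>, one-sided at end points belonging to \<open>S\<close>.\<close>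

definition C1_on :: "real set \<Rightarrow> (real \<Rightarrow> real) \<Rightarrow> (real \<Rightarrow> real) \<Rightarrow> bool" where
  "C1_on S \<phi> \<phi>' \<longleftrightarrow>
     (\<forall>x\<in>S. (\<phi> has_real_derivative \<phi>' x) (at x within S)) \<and> continuous_on S \<phi>'"

text \<open>
  Viscosity sub- and super-solutions of \<open>w + H(w\<^sub>x, x) = 0\<close> on \<open>S\<close>. For \<open>S = branch a\<close> this is the
  notion in the open branch. For \<open>S = insert 0 (branch a)\<close> the test functions may touch at \<open>0\<close>
  from one side, so a super-solution is a state-constraint super-solution up to \<open>0\<close>.
\<close>

definition visc_sub :: "(real \<Rightarrow> real \<Rightarrow> real) \<Rightarrow> real set \<Rightarrow> (real \<Rightarrow> real) \<Rightarrow> bool" where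
  "visc_sub H S w \<longleftrightarrow>
     (\<forall>\<phi> \<phi>'. C1_on S \<phi> \<phi>' \<longrightarrow>
        (\<forall>x\<in>S. local_max_on (\<lambda>y. w y - \<phi> y) S x \<longrightarrow> w x + H (\<phi>' x) x \<le> 0))"

definition visc_super :: "(real \<Rightarrow> real \<Rightarrow> real) \<Rightarrow> real set \<Rightarrow> (real \<Rightarrow> real) \<Rightarrow> bool" where
  "visc_super H S w \<longleftrightarrow>
     (\<forall>\<phi> \<phi>'. C1_on S \<phi> \<phi>' \<longrightarrow>
        (\<forall>x\<in>S. local_min_on (\<lambda>y. w y - \<phi> y) S x \<longrightarrow> 0 \<le> w x + H (\<phi>' x) x))"

definition coercive_on :: "real set \<Rightarrow> (real \<Rightarrow> real \<Rightarrow> real) \<Rightarrow> bool" where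
  "coercive_on S H \<longleftrightarrow> (\<forall>M. \<exists>R. \<forall>p. \<forall>x\<in>S. R \<le> \<bar>p\<bar> \<longrightarrow> M \<le> H p x)"

definition no_flat_parts :: "(real \<Rightarrow> real) \<Rightarrow> bool" where
  "no_flat_parts h \<longleftrightarrow> (\<forall>p q. p < q \<longrightarrow> \<not> h constant_on {p..q})"

text \<open>
  The minimum point of \<open>p \<mapsto> H p 0\<close>; it exists and is unique if this function is continuous, convex,
  coercive and without flat parts.
\<close>

definition min_point :: "(real \<Rightarrow> real \<Rightarrow> real) \<Rightarrow> real" where
  "min_point H = arg_min (\<lambda>p. H p 0) (\<lambda>p. True)"

definition H_minus :: "(real \<Rightarrow> real \<Rightarrow> real) \<Rightarrow> real \<Rightarrow> real" where
  "H_minus H p = (if min_point H \<le> p then H p 0 else H (min_point H) 0)"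

definition H_flux :: "real \<Rightarrow> ('k::finite \<Rightarrow> real \<Rightarrow> real \<Rightarrow> real) \<Rightarrow> ('k \<Rightarrow> real) \<Rightarrow> real" where
  "H_flux A H p = max A (MAX i. H_minus (H i) (p i))"

definition junction_test ::
    "('k::finite \<Rightarrow> ereal) \<Rightarrow> (real ^ 'k \<Rightarrow> real) \<Rightarrow> ('k \<Rightarrow> real \<Rightarrow> real) \<Rightarrow> bool" where
  "junction_test a \<phi> \<phi>' \<longleftrightarrow>
     continuous_on (junction a) \<phi> \<and>
     (\<forall>i. C1_on (insert 0 (branch (a i))) (on_branch \<phi> i) (\<phi>' i))"

definition flux_limited_sub ::
    "('k::finite \<Rightarrow> ereal) \<Rightarrow> ('k \<Rightarrow> real \<Rightarrow> real \<Rightarrow> real) \<Rightarrow> real \<Rightarrow> (real ^ 'k \<Rightarrow> real) \<Rightarrow> bool" where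
  "flux_limited_sub a H A u \<longleftrightarrow>
     continuous_on (junction a) u \<and>
     (\<forall>i. visc_sub (H i) (branch (a i)) (on_branch u i)) \<and>
     (\<forall>\<phi> \<phi>'. junction_test a \<phi> \<phi>' \<longrightarrow> local_max_on (\<lambda>x. u x - \<phi> x) (junction a) 0 \<longrightarrow>
        u 0 + H_flux A H (\<lambda>i. \<phi>' i 0) \<le> 0)"

definition flux_limited_super ::
    "('k::finite \<Rightarrow> ereal) \<Rightarrow> ('k \<Rightarrow> real \<Rightarrow> real \<Rightarrow> real) \<Rightarrow> real \<Rightarrow> (real ^ 'k \<Rightarrow> real) \<Rightarrow> bool" where
  "flux_limited_super a H A v \<longleftrightarrow>
     continuous_on (junction a) v \<and>
     (\<forall>i. visc_super (H i) (branch (a i)) (on_branch v i)) \<and>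
     (\<forall>\<phi> \<phi>'. junction_test a \<phi> \<phi>' \<longrightarrow> local_min_on (\<lambda>x. v x - \<phi> x) (junction a) 0 \<longrightarrow>
        0 \<le> v 0 + H_flux A H (\<lambda>i. \<phi>' i 0))"

text \<open>
  A boundary condition at \<open>- a\<close> is represented by two predicates on functions on the closed branch:
  \<open>Bsub w\<close> and \<open>Bsuper w\<close> say that \<open>w\<close> satisfies it as a sub- resp. super-solution. Any condition
  is allowed (Dirichlet, Neumann, state-constraint, or a growth condition if \<open>a = \<infinity>\<close>), provided that
  it is admissible in the following sense: comparison holds for the equation on the single branch.
\<close>

definition branch_comparison ::
    "ereal \<Rightarrow> (real \<Rightarrow> real \<Rightarrow> real) \<Rightarrow> ((real \<Rightarrow> real) \<Rightarrow> bool) \<Rightarrow> ((real \<Rightarrow> real) \<Rightarrow> bool) \<Rightarrow> bool" where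
  "branch_comparison a H Bsub Bsuper \<longleftrightarrow>
     (\<forall>w z. continuous_on (cbranch a) w \<longrightarrow> visc_sub H (branch a) w \<longrightarrow> Bsub w \<longrightarrow>
            continuous_on (cbranch a) z \<longrightarrow> visc_super H (branch a) z \<longrightarrow> Bsuper z \<longrightarrow>
            w 0 \<le> z 0 \<or> visc_super H (insert 0 (branch a)) z \<longrightarrow>
            (\<forall>x\<in>cbranch a. w x \<le> z x))"

end

theory Submission
  imports Defs
begin

text \<open>
  Everything reduces to the inequality \<open>u 0 \<le> v 0\<close>: once it is known, the admissibility of the
  boundary conditions gives \<open>u \<le> v\<close> on each branch separately.

  Suppose \<open>v 0 < u 0\<close>. Coercivity makes the sub-solution at most linearly growing away from the
  junction, so at \<open>0\<close> it can be touched from above by functions that are linear on every branch, with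
  slopes as negative as desired (\<open>subsolution_linear_upper_bound\<close>). Slopes to the left of the minimum
  points \<open>p\<^sub>i\<^sup>0\<close> turn the junction condition into \<open>u 0 + A \<le> 0\<close> and \<open>u 0 + H\<^sub>i(p\<^sub>i\<^sup>0, 0) \<le> 0\<close> for all \<open>i\<close>
  (\<open>flux_limited_sub_at_junction\<close>). Hence, strictly, \<open>v 0 + A < 0\<close> and \<open>v 0 + H\<^sub>i(p\<^sub>i\<^sup>0, 0) < 0\<close>.

  With these strict inequalities \<open>v\<close> must be a state-constraint super-solution up to \<open>0\<close> on at least one
  branch (\<open>super_state_constraint_on_some_branch\<close>). Otherwise the state-constraint inequality fails
  at \<open>0\<close> on every branch, for slopes \<open>p\<^sub>i\<close> with \<open>v 0 + H\<^sub>i(p\<^sub>i, 0) < 0\<close>; the linear functions with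
  these slopes glue to a test function at the junction, where the super-solution property requires one of
  \<open>v 0 + A\<close>, \<open>v 0 + H\<^sub>i\<^sup>-(p\<^sub>i, 0)\<close> to be nonnegative. But \<open>H\<^sub>i\<^sup>-(p\<^sub>i, 0)\<close> is either \<open>H\<^sub>i(p\<^sub>i, 0)\<close> or
  \<open>H\<^sub>i(p\<^sub>i\<^sup>0, 0)\<close>, so all of these numbers are negative. On the branch found in this way the comparison for
  state-constraint super-solutions applies and gives \<open>u 0 \<le> v 0\<close>, a contradiction.
\<close>

section \<open>The junction near its centre\<close>

lemma zero_in_cbranch: "0 < a \<Longrightarrow> 0 \<in> cbranch a"
  by (simp add: cbranch_def ereal_uminus_le_reorder less_imp_le flip: zero_ereal_def)

lemma branch_subset_cbranch: "branch a \<subseteq> cbranch a"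
  by (auto simp: branch_def cbranch_def)

lemma open_branch: "open (branch a)"
proof -
  have "branch a = (ereal -` {- a<..}) \<inter> {..<0}"
    by (auto simp: branch_def)
  moreover have "open (ereal -` {- a<..})"
    by (intro open_vimage continuous_on_ereal continuous_on_id open_greaterThan)
  ultimately show ?thesis by auto
qed

lemma branch_near_zero:
  assumes "0 < a"
  obtains d where "0 < d" "{- d..<0} \<subseteq> branch a"
proof -
  have "- a < ereal 0"
    using assms by (simp add: ereal_uminus_less_reorder flip: zero_ereal_def)
  then obtain s where "- a < ereal s" "ereal s < ereal 0"
    using ereal_dense2 by blast
  moreover have "{s..<0} \<subseteq> branch a"
    using \<open>- a < ereal s\<close> by (auto simp: branch_def intro: less_le_trans)
  ultimately show ?thesis
    using that[of "- s"] by simp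
qed

text \<open>
  The length of the branch and the status of its end point do not influence limits at the junction, so
  the local notions on the open, half-open and closed branch agree at \<open>0\<close>.
\<close>

lemma at_zero_within_between_branch:
  assumes "0 < a" "branch a \<subseteq> S" "S \<subseteq> {..0}"
  shows "at 0 within S = at_left (0::real)"
proof -
  obtain d where d: "0 < d" "{- d..<0} \<subseteq> branch a"
    using branch_near_zero[OF assms(1)] .
  show ?thesis
  proof (rule at_within_nhd)
    show "(0::real) \<in> {- d<..}" "open {- d<..}" using d by auto
    have "t \<in> S" if "- d < t" "t < 0" for t
      using that d(2) assms(2) by (meson atLeastLessThan_iff less_imp_le subsetD)
    moreover have "t \<le> 0" if "t \<in> S" for t
      using that assms(3) by (meson atMost_iff subsetD)
    ultimately show "S \<inter> {- d<..} - {0} = {..<0} \<inter> {- d<..} - {0}"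
      by force
  qed
qed

lemma at_zero_within_cbranch: "0 < a \<Longrightarrow> at 0 within cbranch a = at_left 0"
  by (rule at_zero_within_between_branch) (auto simp: branch_def cbranch_def)

lemma at_zero_within_insert_branch: "0 < a \<Longrightarrow> at 0 within insert 0 (branch a) = at_left 0"
  by (rule at_zero_within_between_branch) (auto simp: branch_def)

lemma continuous_on_on_branch:
  assumes "continuous_on (junction a) f"
  shows "continuous_on (cbranch (a i)) (on_branch f i)"
proof -
  have "continuous_on (cbranch (a i)) (\<lambda>t. f (t *\<^sub>R axis i 1))"
  proof (rule continuous_on_compose2[OF assms])
    show "continuous_on (cbranch (a i)) (\<lambda>t. t *\<^sub>R axis i (1::real))"
      by (intro continuous_intros)
  qed (auto simp: junction_def)
  then show ?thesis by (simp add: on_branch_def[abs_def])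
qed

lemma local_max_on_junctionI:
  fixes a :: "'k::finite \<Rightarrow> ereal"
  assumes "\<And>i. local_max_on (on_branch f i) (cbranch (a i)) 0"
  shows "local_max_on f (junction a) 0"
proof -
  have "\<exists>d>0. \<forall>t\<in>cbranch (a i). t \<noteq> 0 \<and> dist t 0 < d \<longrightarrow> on_branch f i t \<le> f 0" for i
    using assms[of i] by (simp add: local_max_on_def eventually_at on_branch_def)
  then obtain d where d: "\<And>i. 0 < d i"
    "\<And>i t. t \<in> cbranch (a i) \<Longrightarrow> t \<noteq> 0 \<Longrightarrow> \<bar>t\<bar> < d i \<Longrightarrow> on_branch f i t \<le> f 0"
    by (auto simp: dist_real_def) metis
  have "f x \<le> f 0" if "x \<in> junction a" "x \<noteq> 0" "norm x < Min (range d)" for x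
  proof -
    obtain i t where "t \<in> cbranch (a i)" and x: "x = t *\<^sub>R axis i 1"
      using \<open>x \<in> junction a\<close> by (auto simp: junction_def)
    moreover have "t \<noteq> 0" using x \<open>x \<noteq> 0\<close> by auto
    moreover have "\<bar>t\<bar> < d i" using that(3) by (simp add: x norm_axis_1)
    ultimately show ?thesis using d(2)[of t i] by (simp add: on_branch_def)
  qed
  moreover have "0 < Min (range d)" using d(1) by simp
  ultimately show ?thesis
    unfolding local_max_on_def eventually_at by (auto intro!: exI[of _ "Min (range d)"])
qed

lemma local_min_on_junctionI:
  fixes a :: "'k::finite \<Rightarrow> ereal"
  assumes "\<And>i. local_min_on (on_branch f i) (cbranch (a i)) 0"
  shows "local_min_on f (junction a) 0"
  using local_max_on_junctionI[of "\<lambda>x. - f x" a] assms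
  by (simp add: local_max_on_def local_min_on_def on_branch_def)

section \<open>Test functions that are linear on every branch\<close>

text \<open>
  These are the restrictions to the junction of linear functionals, with slope \<open>p $ i\<close> on the \<open>i\<close>-th branch.
  They are \<open>C\<^sup>1\<close> up to the end points \<open>- a i\<close>, whereas an arbitrary \<open>C\<^sup>1\<close> function on the half-open
  branch need not extend continuously to the closed one.
\<close>

lemma on_branch_inner: "on_branch ((\<bullet>) p) i t = p $ i * t"
  by (simp add: on_branch_def inner_axis)

lemma junction_test_inner: "junction_test a ((\<bullet>) p) (\<lambda>i _. p $ i)"
proof -
  have "C1_on S (on_branch ((\<bullet>) p) i) (\<lambda>_. p $ i)" for S i
    unfolding C1_on_def on_branch_inner[abs_def]
    by (auto intro!: derivative_eq_intros)
  then show ?thesis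
    by (auto simp: junction_test_def intro!: continuous_intros)
qed

lemma flux_limited_sub_linear_test:
  fixes a :: "'k::finite \<Rightarrow> ereal"
  assumes "flux_limited_sub a H A u"
    and "\<And>i. local_max_on (\<lambda>t. on_branch u i t - p i * t) (cbranch (a i)) 0"
  shows "u 0 + H_flux A H p \<le> 0"
proof -
  have "on_branch (\<lambda>x. u x - (\<chi> i. p i) \<bullet> x) i t = on_branch u i t - p i * t" for i t
    using on_branch_inner[of "\<chi> i. p i" i t] by (simp add: on_branch_def)
  then have "local_max_on (\<lambda>x. u x - (\<chi> i. p i) \<bullet> x) (junction a) 0"
    using assms(2) by (intro local_max_on_junctionI) (simp add: local_max_on_def)
  then show ?thesis
    using assms(1) junction_test_inner[of a "\<chi> i. p i"]
    unfolding flux_limited_sub_def by fastforce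
qed

lemma flux_limited_super_linear_test:
  fixes a :: "'k::finite \<Rightarrow> ereal"
  assumes "flux_limited_super a H A v"
    and "\<And>i. local_min_on (\<lambda>t. on_branch v i t - p i * t) (cbranch (a i)) 0"
  shows "0 \<le> v 0 + H_flux A H p"
proof -
  have "on_branch (\<lambda>x. v x - (\<chi> i. p i) \<bullet> x) i t = on_branch v i t - p i * t" for i t
    using on_branch_inner[of "\<chi> i. p i" i t] by (simp add: on_branch_def)
  then have "local_min_on (\<lambda>x. v x - (\<chi> i. p i) \<bullet> x) (junction a) 0"
    using assms(2) by (intro local_min_on_junctionI) (simp add: local_min_on_def)
  then show ?thesis
    using assms(1) junction_test_inner[of a "\<chi> i. p i"]
    unfolding flux_limited_super_def by fastforce
qed

section \<open>The sub-solution at the junction\<close>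

text \<open>
  Near \<open>0\<close> the function \<open>w\<close> is bounded below, so by coercivity no slope \<open>p\<close> with \<open>\<bar>p\<bar>\<close> large can
  touch \<open>w\<close> from above at a point of the open branch. If \<open>- p\<close> is also large compared with the oscillation of
  \<open>w\<close> on a short interval \<open>[- d, 0]\<close>, then \<open>w t - p * t\<close> is at most \<open>w 0\<close> at \<open>t = - d\<close>. Its maximum
  over the interval is therefore attained at \<open>0\<close>.
\<close>

lemma subsolution_linear_upper_bound:
  assumes "0 < a" and coercive: "coercive_on (cbranch a) H"
    and cont: "continuous_on (cbranch a) w" and sub: "visc_sub H (branch a) w"
  shows "\<exists>p\<le>q. local_max_on (\<lambda>t. w t - p * t) (cbranch a) 0"
proof -
  obtain d where d: "0 < d" "{- d..<0} \<subseteq> branch a"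
    using branch_near_zero[OF \<open>0 < a\<close>] .
  have sub_c: "{- d..0} \<subseteq> cbranch a"
  proof
    fix t assume "t \<in> {- d..0}"
    then show "t \<in> cbranch a"
      using subsetD[OF d(2), of t] branch_subset_cbranch[of a] zero_in_cbranch[OF \<open>0 < a\<close>]
      by (cases "t = 0") auto
  qed
  have cont_d: "continuous_on {- d..0} w"
    using cont sub_c continuous_on_subset by blast
  then have "bounded (w ` {- d..0})"
    by (intro compact_imp_bounded compact_continuous_image) auto
  then obtain M where M: "\<And>t. t \<in> {- d..0} \<Longrightarrow> \<bar>w t\<bar> \<le> M"
    unfolding bounded_iff real_norm_def by blast
  obtain R where R: "\<And>p t. t \<in> cbranch a \<Longrightarrow> R \<le> \<bar>p\<bar> \<Longrightarrow> M + 1 \<le> H p t"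
    using coercive unfolding coercive_on_def by metis
  define p where "p = - max (\<bar>R\<bar> + \<bar>q\<bar>) (2 * M / d)"
  have "p \<le> q" "R \<le> \<bar>p\<bar>" "2 * M / d \<le> - p" by (auto simp: p_def)
  then have pd: "2 * M \<le> - p * d" using d(1) by (simp add: field_simps)
  obtain s where s: "s \<in> {- d..0}" "\<And>t. t \<in> {- d..0} \<Longrightarrow> w t - p * t \<le> w s - p * s"
  proof -
    have "continuous_on {- d..0} (\<lambda>t. w t - p * t)"
      using cont_d by (intro continuous_intros)
    then show ?thesis
      using continuous_attains_sup[of "{- d..0}" "\<lambda>t. w t - p * t"] d(1) that by auto
  qed
  have bound: "w t - p * t \<le> w 0" if t: "t \<in> {- d..0}" for t
  proof -
    consider "s = 0" | "s = - d" | "- d < s" "s < 0" using s(1) by fastforce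
    then show ?thesis
    proof cases
      case 1
      then show ?thesis using s(2)[OF t] by simp
    next
      case 2
      then show ?thesis
        using s(2)[OF t] M[of "- d"] M[of 0] pd d(1) by auto
    next
      case 3
      have "\<forall>\<^sub>F t in at s within branch a. t \<in> {- d<..<0}"
        using 3 by (intro eventually_at_topological[THEN iffD2] exI[of _ "{- d<..<0}"]) auto
      then have "local_max_on (\<lambda>t. w t - p * t) (branch a) s"
        unfolding local_max_on_def by eventually_elim (use s(2) in auto)
      moreover have "C1_on (branch a) (\<lambda>t. p * t) (\<lambda>_. p)"
        unfolding C1_on_def by (auto intro!: derivative_eq_intros)
      moreover have "s \<in> branch a" using d(2) 3 by auto
      ultimately have "w s + H p s \<le> 0"
        using sub unfolding visc_sub_def by blast
      moreover have "M + 1 \<le> H p s" using R sub_c s(1) \<open>R \<le> \<bar>p\<bar>\<close> by blast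
      ultimately show ?thesis using M[OF s(1)] by linarith
    qed
  qed
  have "\<forall>\<^sub>F t in at_left 0. t \<in> {- d<..<0}"
    using d(1) eventually_at_left_real[of "- d" 0] by simp
  then have "local_max_on (\<lambda>t. w t - p * t) (cbranch a) 0"
    unfolding local_max_on_def at_zero_within_cbranch[OF \<open>0 < a\<close>]
    by eventually_elim (use bound in auto)
  then show ?thesis using \<open>p \<le> q\<close> by blast
qed

lemma flux_limited_sub_at_junction:
  fixes a :: "'k::finite \<Rightarrow> ereal"
  assumes "\<And>i. 0 < a i" "\<And>i. coercive_on (cbranch (a i)) (H i)" "flux_limited_sub a H A u"
  shows "u 0 + A \<le> 0" "u 0 + H i (min_point (H i)) 0 \<le> 0"
proof -
  have "\<exists>p\<le>min_point (H i). local_max_on (\<lambda>t. on_branch u i t - p * t) (cbranch (a i)) 0" for i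
    using assms by (intro subsolution_linear_upper_bound)
      (auto simp: flux_limited_sub_def intro: continuous_on_on_branch)
  then obtain p where p: "\<And>i. p i \<le> min_point (H i)"
    "\<And>i. local_max_on (\<lambda>t. on_branch u i t - p i * t) (cbranch (a i)) 0"
    by metis
  have "u 0 + H_flux A H p \<le> 0"
    by (rule flux_limited_sub_linear_test[OF assms(3) p(2)])
  moreover have "H_minus (H i) (p i) \<le> H_flux A H p"
    unfolding H_flux_def by (intro max.coboundedI2 Max_ge) auto
  moreover have "H_minus (H i) (p i) = H i (min_point (H i)) 0"
    using p(1)[of i] by (auto simp: H_minus_def)
  moreover have "A \<le> H_flux A H p" by (simp add: H_flux_def)
  ultimately show "u 0 + A \<le> 0" "u 0 + H i (min_point (H i)) 0 \<le> 0" by linarith+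
qed

section \<open>The super-solution at the junction\<close>

text \<open>
  A super-solution in the open branch can violate the state-constraint condition only at \<open>0\<close>. Slightly
  increasing the slope of the violating test function keeps the strict inequality and, since the branch
  lies on the negative side, moves the linear function with this slope below the test function near
  \<open>0\<close> (both normalised to vanish there); so a linear function can be taken instead.
\<close>

lemma not_state_constraint_linear_test:
  assumes "0 < a" and cont: "continuous_on UNIV (\<lambda>p. H p 0)"
    and super: "visc_super H (branch a) z"
    and not_super: "\<not> visc_super H (insert 0 (branch a)) z"
  shows "\<exists>p. local_min_on (\<lambda>t. z t - p * t) (cbranch a) 0 \<and> z 0 + H p 0 < 0"
proof -
  obtain \<phi> \<phi>' x where C1: "C1_on (insert 0 (branch a)) \<phi> \<phi>'"
    and x: "x \<in> insert 0 (branch a)"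
    and lmin: "local_min_on (\<lambda>y. z y - \<phi> y) (insert 0 (branch a)) x"
    and neg: "z x + H (\<phi>' x) x < 0"
    using not_super unfolding visc_super_def by force
  have "x = 0"
  proof (rule ccontr)
    assume "x \<noteq> 0"
    then have xb: "x \<in> branch a" using x by simp
    have "C1_on (branch a) \<phi> \<phi>'"
      using C1 unfolding C1_on_def
      by (auto intro: DERIV_subset continuous_on_subset)
    moreover have "local_min_on (\<lambda>y. z y - \<phi> y) (branch a) x"
      using lmin at_le[of "branch a" "insert 0 (branch a)" x]
      unfolding local_min_on_def by (auto intro: filter_leD)
    ultimately have "0 \<le> z x + H (\<phi>' x) x"
      using super xb unfolding visc_super_def by blast
    then show False using neg by simp
  qed
  define p where "p = \<phi>' 0"
  have "isCont (\<lambda>q. z 0 + H q 0) p"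
    using cont by (intro continuous_intros) (simp add: continuous_on_eq_continuous_at)
  then have "((\<lambda>q. z 0 + H q 0) \<longlongrightarrow> z 0 + H p 0) (at_right p)"
    by (simp add: isCont_def filterlim_at_split)
  then have "\<forall>\<^sub>F q in at_right p. z 0 + H q 0 < 0"
    using neg \<open>x = 0\<close> by (intro order_tendstoD(2)) (auto simp: p_def)
  then have "\<forall>\<^sub>F q in at_right p. z 0 + H q 0 < 0 \<and> p < q"
    by (intro eventually_conj eventually_at_right_less)
  then obtain q where q: "z 0 + H q 0 < 0" "p < q"
    using eventually_happens[of _ "at_right p"] by auto
  have "(\<phi> has_real_derivative p) (at_left 0)"
    using C1 at_zero_within_insert_branch[OF \<open>0 < a\<close>] by (auto simp: C1_on_def p_def)
  then have "((\<lambda>t. (\<phi> t - \<phi> 0) / t) \<longlongrightarrow> p) (at_left 0)"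
    by (simp add: has_field_derivative_iff)
  then have "\<forall>\<^sub>F t in at_left 0. (\<phi> t - \<phi> 0) / t < q"
    using q(2) by (rule order_tendstoD(2))
  moreover have "\<forall>\<^sub>F t in at_left 0. z 0 - \<phi> 0 \<le> z t - \<phi> t"
    using lmin \<open>x = 0\<close> at_zero_within_insert_branch[OF \<open>0 < a\<close>] by (simp add: local_min_on_def)
  moreover have "\<forall>\<^sub>F t in at_left (0::real). t < 0"
    by (simp add: eventually_at_filter)
  ultimately have "\<forall>\<^sub>F t in at_left 0. z 0 \<le> z t - q * t"
  proof eventually_elim
    case (elim t)
    from elim(1,3) have "q * t < \<phi> t - \<phi> 0" by (simp add: field_simps)
    then show ?case using elim(2) by linarith
  qed
  then have "local_min_on (\<lambda>t. z t - q * t) (cbranch a) 0"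
    by (simp add: local_min_on_def at_zero_within_cbranch[OF \<open>0 < a\<close>])
  then show ?thesis using q(1) by blast
qed

text \<open>
  If every branch violates the state-constraint condition, the violating slopes together form one admissible test
  at the junction, and there the two strict inequalities leave no term of the flux-limited
  Hamiltonian that could be large enough.
\<close>

lemma super_state_constraint_on_some_branch:
  fixes a :: "'k::finite \<Rightarrow> ereal"
  assumes "\<And>i. 0 < a i" "\<And>i. continuous_on UNIV (\<lambda>p. H i p 0)"
    and super: "flux_limited_super a H A v"
    and A: "v 0 + A < 0" and min: "\<And>i. v 0 + H i (min_point (H i)) 0 < 0"
  shows "\<exists>i. visc_super (H i) (insert 0 (branch (a i))) (on_branch v i)"
proof (rule ccontr)
  assume "\<not> ?thesis"
  then have "\<exists>p. local_min_on (\<lambda>t. on_branch v i t - p * t) (cbranch (a i)) 0 \<and>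
      on_branch v i 0 + H i p 0 < 0" for i
    using assms(1,2) super
    by (intro not_state_constraint_linear_test) (auto simp: flux_limited_super_def)
  then obtain p where p: "\<And>i. local_min_on (\<lambda>t. on_branch v i t - p i * t) (cbranch (a i)) 0"
    "\<And>i. v 0 + H i (p i) 0 < 0"
    by (simp add: on_branch_def) metis
  have "0 \<le> v 0 + H_flux A H p"
    by (rule flux_limited_super_linear_test[OF super p(1)])
  moreover have "H_minus (H i) (p i) < - v 0" for i
    using p(2)[of i] min[of i] by (auto simp: H_minus_def)
  then have "H_flux A H p < - v 0"
    using A by (auto simp: H_flux_def)
  ultimately show False by simp
qed

section \<open>Comparison\<close>

theorem proposition4p4:
  fixes a :: "'k::finite \<Rightarrow> ereal"
    and H :: "'k \<Rightarrow> real \<Rightarrow> real \<Rightarrow> real"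
    and Bsub Bsuper :: "'k \<Rightarrow> (real \<Rightarrow> real) \<Rightarrow> bool"
    and A :: real
    and u v :: "real ^ 'k \<Rightarrow> real"
  assumes a_pos: "\<And>i. 0 < a i"
    and H_cont: "\<And>i. continuous_on (UNIV \<times> cbranch (a i)) (\<lambda>(p, x). H i p x)"
    and H_coercive: "\<And>i. coercive_on (cbranch (a i)) (H i)"
    and H_convex: "\<And>i x. x \<in> cbranch (a i) \<Longrightarrow> convex_on UNIV (\<lambda>p. H i p x)"
    and H_no_flat: "\<And>i x. x \<in> cbranch (a i) \<Longrightarrow> no_flat_parts (\<lambda>p. H i p x)"
    and bc_admissible: "\<And>i. branch_comparison (a i) (H i) (Bsub i) (Bsuper i)"
    and u_sub: "flux_limited_sub a H A u"
    and u_bc: "\<And>i. Bsub i (on_branch u i)"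
    and v_super: "flux_limited_super a H A v"
    and v_bc: "\<And>i. Bsuper i (on_branch v i)"
  shows "\<forall>x\<in>junction a. u x \<le> v x"
proof -
  have cu: "continuous_on (cbranch (a i)) (on_branch u i)"
    and su: "visc_sub (H i) (branch (a i)) (on_branch u i)" for i
    using u_sub by (auto simp: flux_limited_sub_def intro: continuous_on_on_branch)
  have cv: "continuous_on (cbranch (a i)) (on_branch v i)"
    and sv: "visc_super (H i) (branch (a i)) (on_branch v i)" for i
    using v_super by (auto simp: flux_limited_super_def intro: continuous_on_on_branch)
  have branchwise: "on_branch u i t \<le> on_branch v i t"
    if "u 0 \<le> v 0 \<or> visc_super (H i) (insert 0 (branch (a i))) (on_branch v i)"
      and "t \<in> cbranch (a i)" for i t
  proof -
    have "on_branch u i 0 \<le> on_branch v i 0 \<or>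
        visc_super (H i) (insert 0 (branch (a i))) (on_branch v i)"
      using that(1) by (simp add: on_branch_def)
    then show ?thesis
      using bc_admissible[of i] cu su u_bc cv sv v_bc that(2)
      unfolding branch_comparison_def by blast
  qed
  have "u 0 \<le> v 0"
  proof (rule ccontr)
    assume "\<not> u 0 \<le> v 0"
    then have less: "v 0 < u 0" by simp
    have "continuous_on UNIV (\<lambda>p. H i p 0)" for i
    proof -
      have "continuous_on UNIV (\<lambda>p. (\<lambda>(p, x). H i p x) (p, 0))"
        using zero_in_cbranch[OF a_pos]
        by (intro continuous_on_compose2[OF H_cont[of i]] continuous_intros) auto
      then show ?thesis by simp
    qed
    moreover have "v 0 + A < 0"
      using flux_limited_sub_at_junction(1)[OF a_pos H_coercive u_sub] less by linarith
    moreover have "v 0 + H i (min_point (H i)) 0 < 0" for i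
      using flux_limited_sub_at_junction(2)[OF a_pos H_coercive u_sub, of i] less by linarith
    ultimately obtain i where "visc_super (H i) (insert 0 (branch (a i))) (on_branch v i)"
      using super_state_constraint_on_some_branch[OF a_pos _ v_super] by blast
    then have "on_branch u i 0 \<le> on_branch v i 0"
      using branchwise zero_in_cbranch[OF a_pos] by blast
    then show False using less by (simp add: on_branch_def)
  qed
  then show ?thesis
    using branchwise by (auto simp: junction_def on_branch_def)
qed

end
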